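(* Let $\mathcal{SP}$ be the class of signed graphs whose underlying graph is a (finite) simple planar graph. Then $$\sup\{\chi_c(G,\sigma):(G,\sigma)\in\mathcal{SP}\}\ge 4+\frac{2}{3}.$$
   Context: A signed graph $(G,\sigma)$ is a graph $G$ with a signature $\sigma:E(G)\to\{+,-\}$. For real $r\ge 1$, $C^r$ is the circle of circumference $r$ (points are $[0,r)$), $d_{(\mathrm{mod}\, r)}(x,y)$ is the length of the shorter arc of $C^r$ between $x$ and $y$, and the antipodal $\bar x$ of $x$ is the point at distance $r/2$ from $x$. A circular $r$-coloring of $(G,\sigma)$ is a map $f:V(G)\to C^r$ such that $d_{(\mathrm{mod}\, r)}(f(u),f(v))\ge 1$ for each positive edge $uv$ and $d_{(\mathrm{mod}\, r)}(f(u),\overline{f(v)})\ge 1$ for each negative edge $uv$. $\chi_c(G,\sigma)=\inf\{r\ge 1: (G,\sigma)\text{ admits a circular } r\text{-coloring}\}$. *)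

theory Defs
  imports "HOL-Analysis.Analysis"
begin

section \<open>Signed graphs\<close>

text \<open>Edges are sets of endpoints, so parallel edges are excluded by the representation.\<close>

record 'a ugraph =
  verts :: "'a set"
  edges :: "'a set set"

definition simple_graph :: "'a ugraph \<Rightarrow> bool" where
  "simple_graph G \<longleftrightarrow> (\<forall>e\<in>edges G. e \<subseteq> verts G \<and> card e = 2)"

definition finite_graph :: "'a ugraph \<Rightarrow> bool" where
  "finite_graph G \<longleftrightarrow> finite (verts G) \<and> finite (edges G)"

datatype sign = Pos | Neg

text \<open>Only the values of the signature on the edges of the graph are ever used.\<close>

type_synonym 'a signed_graph = "'a ugraph \<times> ('a set \<Rightarrow> sign)"


section \<open>Planarity\<close>

text \<open>
  A drawing of \<open>G\<close> in the plane, which is identified with the complex numbers: \<open>p\<close> places the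
  vertices, and \<open>\<gamma> e\<close> is a simple arc joining the images of the two endpoints of \<open>e\<close>. An arc passes
  through no vertex other than its ends, and two distinct arcs meet only at common ends.
\<close>

definition plane_drawing ::
  "'a ugraph \<Rightarrow> ('a \<Rightarrow> complex) \<Rightarrow> ('a set \<Rightarrow> real \<Rightarrow> complex) \<Rightarrow> bool" where
  "plane_drawing G p \<gamma> \<longleftrightarrow>
     inj_on p (verts G) \<and>
     (\<forall>e\<in>edges G. arc (\<gamma> e) \<and> {pathstart (\<gamma> e), pathfinish (\<gamma> e)} = p ` e \<and>
        path_image (\<gamma> e) \<inter> p ` verts G = p ` e) \<and>
     (\<forall>e\<in>edges G. \<forall>e'\<in>edges G. e \<noteq> e' \<longrightarrow>
        path_image (\<gamma> e) \<inter> path_image (\<gamma> e') = p ` (e \<inter> e'))"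

definition planar :: "'a ugraph \<Rightarrow> bool" where
  "planar G \<longleftrightarrow> (\<exists>p \<gamma>. plane_drawing G p \<gamma>)"

text \<open>Every finite graph is isomorphic to one on natural numbers, so the instance \<open>'a = nat\<close>
  represents the whole class.\<close>

definition simple_planar_signed_graphs :: "'a signed_graph set" where
  "simple_planar_signed_graphs =
     {(G, \<sigma>). finite_graph G \<and> simple_graph G \<and> planar G}"


section \<open>Circular colorings\<close>

definition circle_pts :: "real \<Rightarrow> real set" where
  "circle_pts r = {0..<r}"

text \<open>For points of \<open>circle_pts r\<close>, the two arcs between \<open>x\<close> and \<open>y\<close> have the lengths
  \<open>\<bar>x - y\<bar>\<close> and \<open>r - \<bar>x - y\<bar>\<close>.\<close>

definition circ_dist :: "real \<Rightarrow> real \<Rightarrow> real \<Rightarrow> real" where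
  "circ_dist r x y = min \<bar>x - y\<bar> (r - \<bar>x - y\<bar>)"

definition antipode :: "real \<Rightarrow> real \<Rightarrow> real" where
  "antipode r x = (THE y. y \<in> circle_pts r \<and> circ_dist r x y = r / 2)"

lemma antipode_eq:
  assumes "x \<in> circle_pts r"
  shows "antipode r x = (if x < r / 2 then x + r / 2 else x - r / 2)"
  unfolding antipode_def
  by (rule the_equality)
    (use assms in \<open>auto simp: circle_pts_def circ_dist_def min_def abs_if field_simps
       split: if_splits\<close>)

definition circular_coloring :: "real \<Rightarrow> 'a signed_graph \<Rightarrow> ('a \<Rightarrow> real) \<Rightarrow> bool" where
  "circular_coloring r S f \<longleftrightarrow> (case S of (G, \<sigma>) \<Rightarrow>
     (\<forall>v\<in>verts G. f v \<in> circle_pts r) \<and>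
     (\<forall>u v. {u, v} \<in> edges G \<and> \<sigma> {u, v} = Pos \<longrightarrow> circ_dist r (f u) (f v) \<ge> 1) \<and>
     (\<forall>u v. {u, v} \<in> edges G \<and> \<sigma> {u, v} = Neg \<longrightarrow>
        circ_dist r (f u) (antipode r (f v)) \<ge> 1))"

text \<open>On finite simple signed graphs the set is nonempty: for large \<open>r\<close>, spread the vertices
  inside a half circle.\<close>

definition circular_chromatic_number :: "'a signed_graph \<Rightarrow> real" where
  "circular_chromatic_number S = Inf {r. r \<ge> 1 \<and> (\<exists>f. circular_coloring r S f)}"

end

theory Submission
  imports Defs
begin

text \<open>
  A single planar signed graph has circular chromatic number at least \<open>14/3\<close>. Rescale a coloring
  with \<open>r < 14/3\<close> to the circle of circumference \<open>14\<close>: then positive edges join points at distance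
  more than \<open>3\<close>, negative edges points at distance less than \<open>4\<close>. An all-positive \<open>K\<^sub>4\<close> needs four
  gaps larger than \<open>3\<close>, so two of its vertices that are not cyclically adjacent are at distance
  more than \<open>6\<close>. Attaching to each of the three edges at one vertex a gadget that excludes
  distances above \<open>6\<close> between its ends makes the graph uncolorable. The gadget is a variant of a
  Wenger graph, with two of its facial triangles filled by a triangle that keeps the corners (one of
  them replaced by its antipode) from lying in an arc of length \<open>2\<close>.
\<close>

section \<open>Circular colorings rescaled to circumference 14\<close>

text \<open>Points of the circle are arbitrary reals taken modulo 14, and the integer absorbs the
  choice of representative, so that later arguments can work with lifts to the real line. The bound
  3 is strict because r < 14/3 scales one unit to more than 3; then \<open>near\<close>, being far
  from the antipode, has the bound 7 - 3 = 4.\<close>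

definition far :: "real \<Rightarrow> real \<Rightarrow> bool" where
  "far x y \<longleftrightarrow> (\<exists>k::int. 3 < x - y + 14 * of_int k \<and> x - y + 14 * of_int k < 11)"

definition near :: "real \<Rightarrow> real \<Rightarrow> bool" where
  "near x y \<longleftrightarrow> (\<exists>k::int. \<bar>x - y + 14 * of_int k\<bar> < 4)"

lemma farI: "3 < x - y + 14 * of_int k \<Longrightarrow> x - y + 14 * of_int k < 11 \<Longrightarrow> far x y"
  unfolding far_def by blast

lemma nearI: "\<bar>x - y + 14 * of_int k\<bar> < 4 \<Longrightarrow> near x y"
  unfolding near_def by blast

lemma far_minus: "far x y \<Longrightarrow> far (- x) (- y)"
proof -
  assume "far x y"
  then obtain k :: int where "3 < x - y + 14 * of_int k" "x - y + 14 * of_int k < 11"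
    unfolding far_def by blast
  \<comment> \<open>Negation sends the window (3, 11) to (-11, -3); one full turn of 14 restores
    it.\<close>
  then show ?thesis by (intro farI[of _ _ "1 - k"]) auto
qed

lemma near_minus: "near x y \<Longrightarrow> near (- x) (- y)"
proof -
  assume "near x y"
  then obtain k :: int where "\<bar>x - y + 14 * of_int k\<bar> < 4"
    unfolding near_def by blast
  then show ?thesis by (intro nearI[of _ _ "- k"]) auto
qed

lemma far_commute: "far x y \<longleftrightarrow> far y x"
proof -
  have "far y x" if far: "far x y" for x y
  proof -
    from far obtain k :: int where "3 < x - y + 14 * of_int k" "x - y + 14 * of_int k < 11"
      unfolding far_def by blast
    then show ?thesis by (intro farI[of _ _ "1 - k"]) auto
  qed
  then show ?thesis by blast
qed

lemma far_shift: "far x y \<Longrightarrow> far (x + 14 * of_int i) (y + 14 * of_int j)"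
proof -
  assume "far x y"
  then obtain k :: int where "3 < x - y + 14 * of_int k" "x - y + 14 * of_int k < 11"
    unfolding far_def by blast
  then show ?thesis by (intro farI[of _ _ "k - i + j"]) auto
qed

lemma near_shift: "near x y \<Longrightarrow> near (x + 14 * of_int i) (y + 14 * of_int j)"
proof -
  assume "near x y"
  then obtain k :: int where "\<bar>x - y + 14 * of_int k\<bar> < 4"
    unfolding near_def by blast
  then show ?thesis by (intro nearI[of _ _ "k - i + j"]) auto
qed

lemma far_translate: "far x y \<Longrightarrow> far (x + c) (y + c)"
  unfolding far_def by simp

lemma near_translate: "near x y \<Longrightarrow> near (x + c) (y + c)"
  unfolding near_def by simp

lemma far_antipode: "far x (y + 7) \<longleftrightarrow> near x y"
proof
  assume "far x (y + 7)"
  then obtain k :: int where "3 < x - (y + 7) + 14 * of_int k" "x - (y + 7) + 14 * of_int k < 11"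
    unfolding far_def by blast
  then show "near x y" by (intro nearI[of _ _ "k - 1"]) auto
next
  assume "near x y"
  then obtain k :: int where "\<bar>x - y + 14 * of_int k\<bar> < 4"
    unfolding near_def by blast
  then show "far x (y + 7)" by (intro farI[of _ _ "k + 1"]) auto
qed

text \<open>The windows for \<open>x - y\<close> are the translates of (3, 11) by multiples of 14.
  Up to 17 = 14 + 3, where the next one begins, only (3, 11) and its mirror image occur. In the same
  way 10 = 14 - 4 leaves only the window (-4, 4) in \<open>near_lift\<close>.\<close>

lemma far_lift:
  assumes "far x y" "\<bar>x - y\<bar> \<le> 17"
  shows "3 < \<bar>x - y\<bar>" "\<bar>x - y\<bar> < 11"
proof -
  obtain k :: int where k: "3 < x - y + 14 * of_int k" "x - y + 14 * of_int k < 11"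
    using assms(1) by (auto simp: far_def)
  have "real_of_int k < 2" "real_of_int k > -1" using k assms(2) by linarith+
  then have "k = 0 \<or> k = 1" by linarith
  then show "3 < \<bar>x - y\<bar>" "\<bar>x - y\<bar> < 11" using k by auto
qed

lemma near_lift:
  assumes "near x y" "\<bar>x - y\<bar> \<le> 10"
  shows "\<bar>x - y\<bar> < 4"
proof -
  obtain k :: int where k: "\<bar>x - y + 14 * of_int k\<bar> < 4" using assms(1) by (auto simp: near_def)
  have "real_of_int k < 1" "real_of_int k > -1" using k assms(2) by linarith+
  then have "k = 0" by linarith
  then show ?thesis using k by auto
qed

lemma far_representative:
  assumes "far x y"
  obtains i :: int where "3 < x + 14 * of_int i - y" "x + 14 * of_int i - y < 11"
proof -
  obtain k :: int where "3 < x - y + 14 * of_int k" "x - y + 14 * of_int k < 11"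
    using assms by (auto simp: far_def)
  then show ?thesis by (intro that[of k]) auto
qed

lemma near_representative:
  assumes "near x y"
  obtains i :: int where "\<bar>x + 14 * of_int i - y\<bar> < 4"
proof -
  obtain k :: int where "\<bar>x - y + 14 * of_int k\<bar> < 4"
    using assms by (auto simp: near_def)
  then show ?thesis by (intro that[of k]) auto
qed

section \<open>From circular colorings to distances on the circle of circumference 14\<close>

fun admissible :: "('a \<Rightarrow> real) \<Rightarrow> 'a \<times> 'a \<times> sign \<Rightarrow> bool" where
  "admissible g (u, v, Pos) \<longleftrightarrow> far (g u) (g v)"
| "admissible g (u, v, Neg) \<longleftrightarrow> near (g u) (g v)"

lemma far_rescale:
  assumes r: "1 \<le> r" "r < 14 / 3" and dist: "circ_dist r x y \<ge> 1"
  shows "far (x * (14 / r)) (y * (14 / r))"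
proof -
  have s: "14 / r > 3" using r by (simp add: field_simps)
  have xy: "x - y \<ge> 1 \<and> x - y \<le> r - 1 \<or> x - y \<le> - 1 \<and> x - y \<ge> 1 - r"
    using dist by (auto simp: circ_dist_def abs_if split: if_splits)
  have eq: "x * (14 / r) - y * (14 / r) = (x - y) * (14 / r)" by (rule left_diff_distrib[symmetric])
  have bounds: "(14 / r) \<le> t * (14 / r) \<and> t * (14 / r) \<le> 14 - 14 / r"
    if "1 \<le> t" "t \<le> r - 1" for t
  proof
    show "14 / r \<le> t * (14 / r)" using mult_right_mono[OF that(1), of "14 / r"] r by simp
    have "t * (14 / r) \<le> (r - 1) * (14 / r)" using that s by (intro mult_right_mono) auto
    also have "\<dots> = 14 - 14 / r" using r by (simp add: field_simps)
    finally show "t * (14 / r) \<le> 14 - 14 / r" .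
  qed
  from xy show ?thesis
  proof
    assume "x - y \<ge> 1 \<and> x - y \<le> r - 1"
    with bounds[of "x - y"] s show ?thesis unfolding far_def eq by (intro exI[of _ 0]) auto
  next
    assume a: "x - y \<le> - 1 \<and> x - y \<ge> 1 - r"
    have "(x - y) * (14 / r) = - ((y - x) * (14 / r))"
      by (metis minus_diff_eq mult_minus_left)
    with bounds[of "y - x"] a s show ?thesis unfolding far_def eq by (intro exI[of _ 1]) auto
  qed
qed

lemma near_rescale:
  assumes y: "y \<in> circle_pts r" and r: "1 \<le> r" "r < 14 / 3"
    and dist: "circ_dist r x (antipode r y) \<ge> 1"
  shows "near (x * (14 / r)) (y * (14 / r))"
proof -
  have "far (x * (14 / r)) (antipode r y * (14 / r))"
    using far_rescale[OF r dist] .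
  \<comment> \<open>The antipode is 7 ahead or 7 behind; the two differ by a full turn, recorded by
    the integer -1 and removed by the shift below.\<close>
  moreover have "antipode r y * (14 / r) = y * (14 / r) + 7 + 14 * of_int (if y < r / 2 then 0 else - 1)"
    using r antipode_eq[OF y] by (simp add: field_simps)
  ultimately have "far (x * (14 / r)) (y * (14 / r) + 7 + 14 * of_int (if y < r / 2 then 0 else - 1))"
    by simp
  from far_shift[OF this, of 0 "if y < r / 2 then 0 else 1"]
  have "far (x * (14 / r)) (y * (14 / r) + 7)" by (simp add: add.commute split: if_splits)
  then show ?thesis by (simp add: far_antipode)
qed

section \<open>The gadgets\<close>

text \<open>Each new vertex sees two of the three corners, so the gadget and the triangle xyz form
  an octahedron and can be drawn inside that face. The signs come from a cyclically symmetric
  pattern (far from one corner, near the next) by switching at z.\<close>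

definition triangle_gadget :: "nat \<Rightarrow> nat \<Rightarrow> nat \<Rightarrow> nat \<Rightarrow> (nat \<times> nat \<times> sign) list" where
  "triangle_gadget x y z n =
    [(n, x, Pos), (n, y, Neg), (n+1, y, Pos), (n+1, z, Pos), (n+2, z, Neg), (n+2, x, Neg),
     (n, n+1, Pos), (n+1, n+2, Pos), (n, n+2, Pos)]"

text \<open>With positive \<open>xz\<close>, \<open>yz\<close> and negative \<open>xy\<close> in mind, \<open>z\<close> enters through its antipode
  \<open>z + 7\<close>: then all three sides of the triangle are negative.\<close>

definition triangle_rel :: "real \<Rightarrow> real \<Rightarrow> real \<Rightarrow> bool" where
  "triangle_rel x y z \<longleftrightarrow> (\<exists>a b c. far a x \<and> near a y \<and> far b y \<and> far b z \<and>
     near c z \<and> near c x \<and> far a b \<and> far b c \<and> far a c)"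

lemma triangle_gadget_rel:
  "\<forall>e\<in>set (triangle_gadget x y z n). admissible g e \<Longrightarrow> triangle_rel (g x) (g y) (g z)"
  unfolding triangle_gadget_def triangle_rel_def by auto

lemma triangle_rel_minus:
  "triangle_rel x y z \<Longrightarrow> triangle_rel (- x) (- y) (- z)"
  unfolding triangle_rel_def
  by (elim exE) (rule exI, rule exI, rule exI, blast intro: far_minus near_minus)

lemma triangle_rel_shift:
  "triangle_rel x y z \<Longrightarrow>
    triangle_rel (x + 14 * of_int i) (y + 14 * of_int j) (z + 14 * of_int k)"
  unfolding triangle_rel_def
  \<comment> \<open>The inner vertices stay where they are; adding \<open>14 * of_int 0\<close> only
    gives the witnesses the shape of the shift lemmas.\<close>
  by (elim exE)
    (rule exI[of _ "_ + 14 * of_int 0"], rule exI[of _ "_ + 14 * of_int 0"],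
      rule exI[of _ "_ + 14 * of_int 0"], blast intro: far_shift near_shift)

lemma triangle_rel_translate:
  "triangle_rel x y z \<Longrightarrow> triangle_rel (x + t) (y + t) (z + t)"
  unfolding triangle_rel_def
  by (elim exE) (rule exI, rule exI, rule exI, blast intro: far_translate near_translate)

text \<open>Each of a, b, c lies more than 3 to the left or to the right of some corner, so two of
  them are on the same side. There both are confined to an open interval from 3 beyond the least
  corner to 4 beyond the greatest (or its mirror image), of length at most 2 + 1 = 3, too short for
  a distance above 3.\<close>

lemma triangle_rel_spread_aux:
  fixes x y z a b c :: real
  assumes "3 < \<bar>a - x\<bar>" "\<bar>a - y\<bar> < 4" "3 < \<bar>b - y\<bar>" "\<bar>b - z\<bar> < 4" "3 < \<bar>c - z\<bar>" "\<bar>c - x\<bar> < 4"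
    and "3 < \<bar>a - b\<bar>" "3 < \<bar>b - c\<bar>" "3 < \<bar>a - c\<bar>"
    and "\<bar>x - y\<bar> \<le> 2" "\<bar>x - z\<bar> \<le> 2" "\<bar>y - z\<bar> \<le> 2"
  shows False
  using assms by (smt (verit))

lemma triangle_rel_spread:
  assumes "triangle_rel x y z"
  shows "\<not> (\<bar>x - y\<bar> \<le> 2 \<and> \<bar>x - (z + 7)\<bar> \<le> 2 \<and> \<bar>y - (z + 7)\<bar> \<le> 2)"
proof
  assume close: "\<bar>x - y\<bar> \<le> 2 \<and> \<bar>x - (z + 7)\<bar> \<le> 2 \<and> \<bar>y - (z + 7)\<bar> \<le> 2"
  define z' where "z' = z + 7"
  obtain a b c where abc: "far a x" "near a y" "far b y" "near b z'" "far c z'" "near c x"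
    "far a b" "far b c" "far a c"
  proof -
    obtain a b c where abc: "far a x" "near a y" "far b y" "far b z" "near c z" "near c x"
      "far a b" "far b c" "far a c" using assms unfolding triangle_rel_def by blast
    have "far b (z + 14 * of_int 1)" using far_shift[OF abc(4), of 0 1] by simp
    then have "near b (z + 7)" by (simp add: far_antipode[symmetric] add.assoc)
    moreover have "far c (z + 7)" using abc(5) by (simp add: far_antipode)
    ultimately show thesis using that abc unfolding z'_def by blast
  qed
  \<comment> \<open>Lifting each inner vertex next to the corner it is near keeps all differences
    within 10, where \<open>far_lift\<close> applies.\<close>
  obtain i :: int where i: "\<bar>a + 14 * of_int i - y\<bar> < 4" using abc(2) by (rule near_representative)
  obtain j :: int where j: "\<bar>b + 14 * of_int j - z'\<bar> < 4" using abc(4) by (rule near_representative)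
  obtain k :: int where k: "\<bar>c + 14 * of_int k - x\<bar> < 4" using abc(6) by (rule near_representative)
  define a' where "a' = a + 14 * of_int i"
  define b' where "b' = b + 14 * of_int j"
  define c' where "c' = c + 14 * of_int k"
  note defs = a'_def b'_def c'_def
  have c1: "\<bar>x - y\<bar> \<le> 2" "\<bar>x - z'\<bar> \<le> 2" "\<bar>y - z'\<bar> \<le> 2" using close unfolding z'_def by auto
  have n: "\<bar>a' - y\<bar> < 4" "\<bar>b' - z'\<bar> < 4" "\<bar>c' - x\<bar> < 4" using i j k unfolding defs by auto
  have "far a' x" "far b' y" "far c' z'" "far a' b'" "far b' c'" "far a' c'"
    using far_shift[OF abc(1), of i 0] far_shift[OF abc(3), of j 0] far_shift[OF abc(5), of k 0]
      far_shift[OF abc(7), of i j] far_shift[OF abc(8), of j k] far_shift[OF abc(9), of i k]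
    unfolding defs by auto
  note f = this[THEN far_lift(1)]
  show False
    by (rule triangle_rel_spread_aux[OF f(1) n(1) f(2) n(2) f(3) n(3) f(4-6) c1])
      (use n c1 in linarith)+
qed

text \<open>The inner vertices \<open>n, \<dots>, n + 7\<close> are called \<open>A, B, C, D, E, F, G, Z\<close> below. The neighbors of
  \<open>u\<close> in cyclic order are \<open>A, E, F, G, B\<close>, those of \<open>v\<close> are \<open>A, C, D, B\<close>.\<close>

definition wenger_gadget :: "nat \<Rightarrow> nat \<Rightarrow> nat \<Rightarrow> (nat \<times> nat \<times> sign) list" where
  "wenger_gadget u v n =
    [(n, u, Pos), (n+1, u, Pos), (n+4, u, Pos), (n+5, u, Pos), (n+6, u, Pos),
     (n, v, Pos), (n+1, v, Pos), (n+2, v, Neg), (n+3, v, Neg),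
     (n, n+2, Pos), (n+2, n+3, Pos), (n+3, n+1, Pos), (n, n+4, Pos), (n+4, n+5, Pos),
     (n+5, n+6, Pos), (n+6, n+1, Pos), (n+4, n+2, Pos), (n+6, n+3, Pos),
     (n+7, n+3, Pos), (n+7, n+5, Pos), (n+7, n+6, Pos), (n+7, n+4, Neg), (n+7, n+2, Neg)]
    @ triangle_gadget (n+4) (n+7) (n+5) (n+8) @ triangle_gadget (n+2) (n+7) (n+3) (n+11)"

text \<open>A < 4 + d pushes C and E above 6, and they are more than 3 apart; B lies below 4 + d or
  above 10 + d. In each resulting case, chasing distances through D, G, F and Z either gives a clash
  or leaves three points pairwise within 2: C, Z, D + 7 if E < C, against T2, and E, Z, F + 7 if C <
  E, against T1.\<close>

lemma wenger_core:
  fixes A B C D E F G Z d :: real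
  assumes d: "\<bar>d\<bar> < 1"
    and A: "3 < A" "A < 4 + d" and B: "3 < B" "B < 11" "3 < \<bar>B - (7 + d)\<bar>"
    and C: "3 + d < C" "C < 11 + d" and D: "3 + d < D" "D < 11 + d"
    and E: "3 < E" "E < 11" and F: "3 < F" "F < 11" and G: "3 < G" "G < 11"
    and AC: "3 < \<bar>A - C\<bar>" and CD: "3 < \<bar>C - D\<bar>" and DB: "3 < \<bar>D - B\<bar>"
    and AE: "3 < \<bar>A - E\<bar>" and EF: "3 < \<bar>E - F\<bar>" and FG: "3 < \<bar>F - G\<bar>" and GB: "3 < \<bar>G - B\<bar>"
    and EC: "3 < \<bar>E - C\<bar>" and GD: "3 < \<bar>G - D\<bar>"
    and ZC: "\<bar>Z - C\<bar> < 4" and ZE: "\<bar>Z - E\<bar> < 4"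
    and ZD: "3 < \<bar>Z - D\<bar>" "\<bar>Z - D\<bar> < 11" and ZF: "3 < \<bar>Z - F\<bar>" "\<bar>Z - F\<bar> < 11"
    and ZG: "3 < \<bar>Z - G\<bar>" "\<bar>Z - G\<bar> < 11"
    and T1: "\<not> (\<bar>E - Z\<bar> \<le> 2 \<and> \<bar>E - (F + 7)\<bar> \<le> 2 \<and> \<bar>Z - (F + 7)\<bar> \<le> 2)"
            "\<not> (\<bar>E - Z\<bar> \<le> 2 \<and> \<bar>E - (F - 7)\<bar> \<le> 2 \<and> \<bar>Z - (F - 7)\<bar> \<le> 2)"
    and T2: "\<not> (\<bar>C - Z\<bar> \<le> 2 \<and> \<bar>C - (D + 7)\<bar> \<le> 2 \<and> \<bar>Z - (D + 7)\<bar> \<le> 2)"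
            "\<not> (\<bar>C - Z\<bar> \<le> 2 \<and> \<bar>C - (D - 7)\<bar> \<le> 2 \<and> \<bar>Z - (D - 7)\<bar> \<le> 2)"
  shows False
  using assms by (smt (verit))

text \<open>The ends of the gadget are at \<open>0\<close> and \<open>7 + d\<close>.\<close>

definition wenger_rel ::
  "real \<Rightarrow> real \<Rightarrow> real \<Rightarrow> real \<Rightarrow> real \<Rightarrow> real \<Rightarrow> real \<Rightarrow> real \<Rightarrow> real \<Rightarrow> bool" where
  "wenger_rel d A B C D E F G Z \<longleftrightarrow>
    far A 0 \<and> far B 0 \<and> far E 0 \<and> far F 0 \<and> far G 0 \<and>
    far A (7 + d) \<and> far B (7 + d) \<and> near C (7 + d) \<and> near D (7 + d) \<and>
    far A C \<and> far C D \<and> far D B \<and> far A E \<and> far E F \<and> far F G \<and> far G B \<and> far E C \<and> far G D \<and>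
    far Z D \<and> far Z F \<and> far Z G \<and> near Z E \<and> near Z C \<and>
    triangle_rel E Z F \<and> triangle_rel C Z D"

section \<open>Normalizing positions by full turns and by reflection\<close>

lemma wenger_rel_shift:
  assumes "wenger_rel d A B C D E F G Z"
  shows "wenger_rel d (A + 14 * of_int iA) (B + 14 * of_int iB) (C + 14 * of_int iC)
    (D + 14 * of_int iD) (E + 14 * of_int iE) (F + 14 * of_int iF) (G + 14 * of_int iG)
    (Z + 14 * of_int iZ)"
proof -
  have f0: "far (x + 14 * of_int i) y" if "far x y" for x y and i :: int
    using far_shift[OF that, of i 0] by simp
  have n0: "near (x + 14 * of_int i) y" if "near x y" for x y and i :: int
    using near_shift[OF that, of i 0] by simp
  show ?thesis using assms unfolding wenger_rel_def
    by (intro conjI; elim conjE)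
      (assumption | erule f0 | erule n0 | erule far_shift | erule near_shift | erule triangle_rel_shift)+
qed

lemma wenger_rel_minus:
  assumes "wenger_rel d A B C D E F G Z"
  shows "wenger_rel (- d) (- A) (- B) (- C) (- D) (- E) (- F) (- G) (- Z)"
proof -
  have f0: "far (- x) 0" if "far x 0" for x using far_minus[OF that] by simp
  have f7: "far (- x) (7 + - d)" if "far x (7 + d)" for x
    using far_shift[OF far_minus[OF that], of 0 1] by (simp add: algebra_simps)
  have n7: "near (- x) (7 + - d)" if "near x (7 + d)" for x
    using near_shift[OF near_minus[OF that], of 0 1] by (simp add: algebra_simps)
  show ?thesis using assms unfolding wenger_rel_def
    by (intro conjI; elim conjE)
      (assumption | erule f0 | erule f7 | erule n7 | erule far_minus | erule near_minus
        | erule triangle_rel_minus)+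
qed

lemma not_wenger_rel_aux:
  assumes W: "wenger_rel d A B C D E F G Z" and d: "\<bar>d\<bar> < 1" and A: "3 < A" "A < 4 + d"
  shows False
proof -
  note W' = W[unfolded wenger_rel_def]
  obtain iB :: int where iB: "3 < B + 14 * of_int iB - 0" "B + 14 * of_int iB - 0 < 11"
    using W' far_representative by metis
  obtain iE :: int where iE: "3 < E + 14 * of_int iE - 0" "E + 14 * of_int iE - 0 < 11"
    using W' far_representative by metis
  obtain iF :: int where iF: "3 < F + 14 * of_int iF - 0" "F + 14 * of_int iF - 0 < 11"
    using W' far_representative by metis
  obtain iG :: int where iG: "3 < G + 14 * of_int iG - 0" "G + 14 * of_int iG - 0 < 11"
    using W' far_representative by metis
  obtain iC :: int where iC: "\<bar>C + 14 * of_int iC - (7 + d)\<bar> < 4"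
    using W' near_representative by metis
  obtain iD :: int where iD: "\<bar>D + 14 * of_int iD - (7 + d)\<bar> < 4"
    using W' near_representative by metis
  \<comment> \<open>Z is adjacent to neither end of the gadget, so its lift is chosen relative to
    that of C.\<close>
  have "near Z (C + 14 * of_int iC)" using near_shift[of Z C 0 iC] W' by simp
  then obtain iZ :: int where iZ: "\<bar>Z + 14 * of_int iZ - (C + 14 * of_int iC)\<bar> < 4"
    by (rule near_representative)
  define B' C' D' E' F' G' Z'
    where defs: "B' = B + 14 * real_of_int iB" "C' = C + 14 * real_of_int iC"
      "D' = D + 14 * real_of_int iD" "E' = E + 14 * real_of_int iE" "F' = F + 14 * real_of_int iF"
      "G' = G + 14 * real_of_int iG" "Z' = Z + 14 * real_of_int iZ"
  have "wenger_rel d A B' C' D' E' F' G' Z'"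
    using wenger_rel_shift[OF W, of 0 iB iC iD iE iF iG iZ] unfolding defs by simp
  note R = this[unfolded wenger_rel_def]
  have rng: "3 < B'" "B' < 11" "3 < E'" "E' < 11" "3 < F'" "F' < 11" "3 < G'" "G' < 11"
    "3 + d < C'" "C' < 11 + d" "3 + d < D'" "D' < 11 + d" "\<bar>Z' - C'\<bar> < 4"
    using iB iE iF iG iC iD iZ unfolding defs by auto
  have Bv: "3 < \<bar>B' - (7 + d)\<bar>" using R rng d by (intro far_lift(1)) auto
  have AC: "3 < \<bar>A - C'\<bar>" using R rng d A by (intro far_lift(1)) auto
  have CD: "3 < \<bar>C' - D'\<bar>" using R rng d by (intro far_lift(1)) auto
  have DB: "3 < \<bar>D' - B'\<bar>" using R rng d by (intro far_lift(1)) auto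
  have AE: "3 < \<bar>A - E'\<bar>" using R rng d A by (intro far_lift(1)) auto
  have EF: "3 < \<bar>E' - F'\<bar>" using R rng d by (intro far_lift(1)) auto
  have FG: "3 < \<bar>F' - G'\<bar>" using R rng d by (intro far_lift(1)) auto
  have GB: "3 < \<bar>G' - B'\<bar>" using R rng d by (intro far_lift(1)) auto
  have EC: "3 < \<bar>E' - C'\<bar>" using R rng d by (intro far_lift(1)) auto
  have GD: "3 < \<bar>G' - D'\<bar>" using R rng d by (intro far_lift(1)) auto
  \<comment> \<open>These lower bounds bring the difference of Z' and E' below 10, as
    \<open>near_lift\<close> requires.\<close>
  have "C' > 6" "E' > 6" using AC AE A rng d by linarith+
  then have ZE: "\<bar>Z' - E'\<bar> < 4" using R rng d by (intro near_lift) auto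
  have ZD: "3 < \<bar>Z' - D'\<bar>" "\<bar>Z' - D'\<bar> < 11" using R rng d by (auto intro!: far_lift)
  have ZF: "3 < \<bar>Z' - F'\<bar>" "\<bar>Z' - F'\<bar> < 11" using R rng d by (auto intro!: far_lift)
  have ZG: "3 < \<bar>Z' - G'\<bar>" "\<bar>Z' - G'\<bar> < 11" using R rng d by (auto intro!: far_lift)
  have TE: "triangle_rel E' Z' F'" and TC: "triangle_rel C' Z' D'" using R by auto
  \<comment> \<open>The antipode of F' has the two relevant lifts F' + 7 and F' - 7; a shift by a
    full turn yields the second, and likewise for D'.\<close>
  have T1: "triangle_rel E' Z' (F' - 14)" and T2: "triangle_rel C' Z' (D' - 14)"
    using triangle_rel_shift[OF TE, of 0 0 "- 1"] triangle_rel_shift[OF TC, of 0 0 "- 1"] by auto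
  have shift: "x - 14 + 7 = x - 7" for x :: real by simp
  note S = triangle_rel_spread[OF TE] triangle_rel_spread[OF T1, unfolded shift]
    triangle_rel_spread[OF TC] triangle_rel_spread[OF T2, unfolded shift]
  show False
    by (rule wenger_core[OF d A rng(1,2) Bv rng(9-12) rng(3-8) AC CD DB AE EF FG GB EC GD rng(13)
          ZE ZD ZF ZG S])
qed

lemma not_wenger_rel:
  assumes W: "wenger_rel d A B C D E F G Z" and d: "\<bar>d\<bar> < 1"
  shows False
proof -
  note W' = W[unfolded wenger_rel_def]
  obtain i :: int where i: "3 < A + 14 * of_int i - 0" "A + 14 * of_int i - 0 < 11"
    using W' far_representative by metis
  define A' where "A' = A + 14 * real_of_int i"
  have W2: "wenger_rel d A' B C D E F G Z"
    using wenger_rel_shift[OF W, of i 0 0 0 0 0 0 0] unfolding A'_def by simp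
  have "far A' (7 + d)" using W2 unfolding wenger_rel_def by simp
  moreover have A': "3 < A'" "A' < 11" using i unfolding A'_def by auto
  ultimately have "3 < \<bar>A' - (7 + d)\<bar>" using d by (intro far_lift(1)) auto
  then consider "A' < 4 + d" | "A' > 10 + d" by linarith
  then show False
  proof cases
    case 1
    then show ?thesis using not_wenger_rel_aux[OF W2 d] A' by simp
  next
    case 2
    \<comment> \<open>Reflection exchanges the two ranges of A: A' > 10 + d becomes 14 - A' < 4 +
      (-d).\<close>
    have "wenger_rel (- d) (14 - A') (- B) (- C) (- D) (- E) (- F) (- G) (- Z)"
      using wenger_rel_shift[OF wenger_rel_minus[OF W2], of 1 0 0 0 0 0 0 0] by simp
    from not_wenger_rel_aux[OF this] show ?thesis using d 2 A' by simp
  qed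
qed

text \<open>Seen from \<open>g u\<close>, the other end is at 7 + d with d its deviation from the
  antipode, and \<open>not_wenger_rel\<close> excludes a deviation below 1. Since k is arbitrary,
  the ends have circular distance at most 6.\<close>

lemma wenger_gadget_dist:
  assumes adm: "\<forall>e\<in>set (wenger_gadget u v n). admissible g e"
  shows "\<bar>g v - g u - 7 + 14 * of_int k\<bar> \<ge> 1"
proof (rule ccontr)
  assume "\<not> ?thesis"
  then have d: "\<bar>g v - g u - 7 + 14 * of_int k\<bar> < 1" by simp
  define d where "d = g v - g u - 7 + 14 * of_int k"
  define h where "h i = g (n + i) + - g u" for i
  have v: "7 + d = g v + - g u + 14 * of_int k" unfolding d_def by simp
  have fu: "far (h i) 0" if "far (g (n + i)) (g u)" for i
    using far_translate[OF that, of "- g u"] unfolding h_def by simp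
  have fv: "far (h i) (7 + d)" if "far (g (n + i)) (g v)" for i
    using far_shift[OF far_translate[OF that, of "- g u"], of 0 k] unfolding h_def v by simp
  have nv: "near (h i) (7 + d)" if "near (g (n + i)) (g v)" for i
    using near_shift[OF near_translate[OF that, of "- g u"], of 0 k] unfolding h_def v by simp
  have ff: "far (h i) (h j)" if "far (g (n + i)) (g (n + j))" for i j
    unfolding h_def using that by (rule far_translate)
  have nn: "near (h i) (h j)" if "near (g (n + i)) (g (n + j))" for i j
    unfolding h_def using that by (rule near_translate)
  have tt: "triangle_rel (h i) (h j) (h l)"
    if "triangle_rel (g (n + i)) (g (n + j)) (g (n + l))" for i j l
    unfolding h_def using that by (rule triangle_rel_translate)
  have t: "triangle_rel (g (n+4)) (g (n+7)) (g (n+5))" "triangle_rel (g (n+2)) (g (n+7)) (g (n+3))"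
    using adm unfolding wenger_gadget_def by (auto intro!: triangle_gadget_rel)
  have n0: "g n = g (n + 0)" by simp
  have "wenger_rel d (h 0) (h 1) (h 2) (h 3) (h 4) (h 5) (h 6) (h 7)"
    unfolding wenger_rel_def using adm t unfolding wenger_gadget_def
    by (intro conjI fu fv nv ff nn tt) auto
  then show False using not_wenger_rel d unfolding d_def by blast
qed


section \<open>Straight-line drawings\<close>

text \<open>Twice the signed area of the triangle abc: its sign tells on which side of the line ab
  the point c lies, and it vanishes exactly for collinear points.\<close>

fun orient :: "'a::linordered_idom \<times> 'a \<Rightarrow> 'a \<times> 'a \<Rightarrow> 'a \<times> 'a \<Rightarrow> 'a" where
  "orient (ax, ay) (bx, by) (cx, cy) = (bx - ax) * (cy - ay) - (by - ay) * (cx - ax)"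

fun same_side :: "'a::linordered_idom \<times> 'a \<Rightarrow> 'a \<times> 'a \<Rightarrow> 'a \<times> 'a \<Rightarrow> 'a \<times> 'a \<Rightarrow> bool" where
  "same_side a b c d \<longleftrightarrow> orient a b c * orient a b d > 0"

definition boxes_disjoint ::
    "'a::linordered_idom \<times> 'a \<Rightarrow> 'a \<times> 'a \<Rightarrow> 'a \<times> 'a \<Rightarrow> 'a \<times> 'a \<Rightarrow> bool" where
  "boxes_disjoint a b c d \<longleftrightarrow>
     max (fst a) (fst b) < min (fst c) (fst d) \<or> max (fst c) (fst d) < min (fst a) (fst b) \<or>
     max (snd a) (snd b) < min (snd c) (snd d) \<or> max (snd c) (snd d) < min (snd a) (snd b)"

text \<open>A sufficient test in exact integer arithmetic, made for evaluation, with the cheap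
  bounding boxes first. Segments sharing an end must not be collinear, so a repeated segment fails
  the test as well.\<close>

fun crossfree :: "(int \<times> int) \<times> (int \<times> int) \<Rightarrow> (int \<times> int) \<times> (int \<times> int) \<Rightarrow> bool" where
  "crossfree (a, b) (c, d) \<longleftrightarrow>
    (if boxes_disjoint a b c d then True
     else if a = c then orient a b d \<noteq> 0 else if a = d then orient a b c \<noteq> 0
     else if b = c then orient b a d \<noteq> 0 else if b = d then orient b a c \<noteq> 0
     else if same_side a b c d then True else same_side c d a b)"

section \<open>Soundness of the integer test for real segments\<close>

definition point :: "int \<times> int \<Rightarrow> complex" where
  "point a = Complex (of_int (fst a)) (of_int (snd a))"

lemma orient_point:
  "of_int (orient a b c) = (Re (point b) - Re (point a)) * (Im (point c) - Im (point a))
     - (Im (point b) - Im (point a)) * (Re (point c) - Re (point a))"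
  by (cases a; cases b; cases c) (simp add: point_def)

lemma inj_point: "point a = point b \<longleftrightarrow> a = b"
  by (cases a; cases b) (simp add: point_def)

text \<open>The affine function L vanishes on the line through a and b. Having one strict sign at c
  and d, it has that sign on their whole segment.\<close>

lemma closed_segment_separated:
  assumes "same_side a b c d"
  shows "closed_segment (point a) (point b) \<inter> closed_segment (point c) (point d) = {}"
proof (rule ccontr)
  assume "\<not> ?thesis"
  then obtain z where z: "z \<in> closed_segment (point a) (point b)"
      "z \<in> closed_segment (point c) (point d)" by blast
  define L where "L w = (Re (point b) - Re (point a)) * (Im w - Im (point a))
     - (Im (point b) - Im (point a)) * (Re w - Re (point a))" for w
  obtain u where u: "z = (1 - u) *\<^sub>R point a + u *\<^sub>R point b"
    using z(1) unfolding closed_segment_def by blast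
  obtain t where t: "0 \<le> t" "t \<le> 1" "z = (1 - t) *\<^sub>R point c + t *\<^sub>R point d"
    using z(2) unfolding closed_segment_def by blast
  have "L z = 0" unfolding L_def u by (simp add: algebra_simps)
  moreover have "L z = (1 - t) * L (point c) + t * L (point d)"
    unfolding L_def t(3) by (simp add: algebra_simps)
  moreover have "L (point c) * L (point d) > 0"
  proof -
    have "of_int (orient a b c * orient a b d) > (0 :: real)"
      using assms by (simp only: same_side.simps of_int_0_less_iff)
    then show ?thesis unfolding of_int_mult orient_point L_def .
  qed
  ultimately show False using t(1,2)
    by (smt (verit) mult_nonneg_nonneg mult_nonneg_nonpos zero_less_mult_iff mult_pos_pos mult_pos_neg)
qed

text \<open>The directions from a to b and from a to c are linearly independent, so a common point
  has parameter 0.\<close>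

lemma closed_segment_common_end:
  assumes "orient a b c \<noteq> 0"
  shows "closed_segment (point a) (point b) \<inter> closed_segment (point a) (point c) \<subseteq> {point a}"
proof
  fix z assume z: "z \<in> closed_segment (point a) (point b) \<inter> closed_segment (point a) (point c)"
  obtain u where u: "z = (1 - u) *\<^sub>R point a + u *\<^sub>R point b"
    using z unfolding closed_segment_def by blast
  obtain t where t: "z = (1 - t) *\<^sub>R point a + t *\<^sub>R point c"
    using z unfolding closed_segment_def by blast
  have Re: "u * (Re (point b) - Re (point a)) = t * (Re (point c) - Re (point a))"
    using arg_cong[OF u[unfolded t], of Re] by (simp add: algebra_simps)
  have Im: "u * (Im (point b) - Im (point a)) = t * (Im (point c) - Im (point a))"
    using arg_cong[OF u[unfolded t], of Im] by (simp add: algebra_simps)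
  have "u * of_int (orient a b c)
      = (u * (Re (point b) - Re (point a))) * (Im (point c) - Im (point a))
        - (u * (Im (point b) - Im (point a))) * (Re (point c) - Re (point a))"
    unfolding orient_point by (simp add: algebra_simps)
  also have "\<dots> = 0" unfolding Re Im by simp
  finally have "u = 0" using assms by simp
  then show "z \<in> {point a}" using u by simp
qed

lemma closed_segment_boxes_disjoint:
  assumes "boxes_disjoint a b c d"
  shows "closed_segment (point a) (point b) \<inter> closed_segment (point c) (point d) = {}"
proof -
  have convex: "min x y \<le> (1 - u) * x + u * y" "(1 - u) * x + u * y \<le> max x y"
    if "0 \<le> u" "u \<le> 1" for u x y :: real
  proof -
    have "(1 - u) * min x y + u * min x y \<le> (1 - u) * x + u * y"
      "(1 - u) * x + u * y \<le> (1 - u) * max x y + u * max x y"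
      using that by (intro add_mono mult_left_mono; simp)+
    moreover have "(1 - u) * m + u * m = m" for m by (simp add: left_diff_distrib)
    ultimately show "min x y \<le> (1 - u) * x + u * y" "(1 - u) * x + u * y \<le> max x y" by simp_all
  qed
  have bounds: "of_int (min (fst a) (fst b)) \<le> Re z" "Re z \<le> of_int (max (fst a) (fst b))"
      "of_int (min (snd a) (snd b)) \<le> Im z" "Im z \<le> of_int (max (snd a) (snd b))"
    if z: "z \<in> closed_segment (point a) (point b)" for z a b
  proof -
    obtain u where u: "0 \<le> u" "u \<le> 1" "z = (1 - u) *\<^sub>R point a + u *\<^sub>R point b"
      using z unfolding closed_segment_def by blast
    have "Re z = (1 - u) * of_int (fst a) + u * of_int (fst b)"
      "Im z = (1 - u) * of_int (snd a) + u * of_int (snd b)"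
      unfolding u(3) by (simp_all add: point_def)
    then show "of_int (min (fst a) (fst b)) \<le> Re z" "Re z \<le> of_int (max (fst a) (fst b))"
      "of_int (min (snd a) (snd b)) \<le> Im z" "Im z \<le> of_int (max (snd a) (snd b))"
      unfolding of_int_min of_int_max by (simp_all only: convex[OF u(1,2)])
  qed
  have "real_of_int (max (fst a) (fst b)) < of_int (min (fst c) (fst d)) \<or>
      real_of_int (max (fst c) (fst d)) < of_int (min (fst a) (fst b)) \<or>
      real_of_int (max (snd a) (snd b)) < of_int (min (snd c) (snd d)) \<or>
      real_of_int (max (snd c) (snd d)) < of_int (min (snd a) (snd b))"
    using assms unfolding boxes_disjoint_def of_int_less_iff .
  then have "False" if z: "z \<in> closed_segment (point a) (point b)"
      "z \<in> closed_segment (point c) (point d)" for z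
    using bounds[OF z(1)] bounds[OF z(2)] by (elim disjE; linarith)
  then show ?thesis by blast
qed

lemma crossfree_closed_segments:
  assumes "crossfree (a, b) (c, d)"
  shows "closed_segment (point a) (point b) \<inter> closed_segment (point c) (point d)
    \<subseteq> {point a, point b} \<inter> {point c, point d}"
proof (cases "boxes_disjoint a b c d \<or> same_side a b c d \<or> same_side c d a b")
  case True
  then have "closed_segment (point a) (point b) \<inter> closed_segment (point c) (point d) = {}"
    using closed_segment_boxes_disjoint[of a b c d] closed_segment_separated[of a b c d]
      closed_segment_separated[of c d a b] by blast
  then show ?thesis by blast
next
  case False
  then consider "a = c" "orient a b d \<noteq> 0" | "a = d" "orient a b c \<noteq> 0"
    | "b = c" "orient b a d \<noteq> 0" | "b = d" "orient b a c \<noteq> 0"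
    using assms by (auto simp del: orient.simps same_side.simps split: if_splits)
  then show ?thesis
  proof cases
    case 1
    then show ?thesis using closed_segment_common_end[of a b d] by auto
  next
    case 2
    then show ?thesis using closed_segment_common_end[of a b c]
      by (auto simp: closed_segment_commute)
  next
    case 3
    then show ?thesis using closed_segment_common_end[of b a d]
      by (auto simp: closed_segment_commute)
  next
    case 4
    then show ?thesis using closed_segment_common_end[of b a c]
      by (auto simp: closed_segment_commute)
  qed
qed

lemma planar_straight_line:
  fixes G :: "'a ugraph" and p :: "'a \<Rightarrow> complex"
  assumes simple: "simple_graph G" and inj: "inj_on p (verts G)"
    and no_isolated: "verts G \<subseteq> \<Union> (edges G)"
    and cross: "\<And>e e'. e \<in> edges G \<Longrightarrow> e' \<in> edges G \<Longrightarrow> e \<noteq> e' \<Longrightarrow>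
      convex hull (p ` e) \<inter> convex hull (p ` e') \<subseteq> p ` (e \<inter> e')"
  shows "planar G"
proof -
  define ends where "ends e = (SOME (i, j). e = {i, j})" for e :: "'a set"
  define \<gamma> where "\<gamma> e = linepath (p (fst (ends e))) (p (snd (ends e)))" for e
  have ends: "e = {fst (ends e), snd (ends e)}" if "e \<in> edges G" for e
  proof -
    have "card e = 2" using that simple unfolding simple_graph_def by blast
    then obtain i j where "e = {i, j}" by (auto simp: card_2_iff)
    then have "\<exists>q. case q of (i, j) \<Rightarrow> e = {i, j}" by auto
    then have "case ends e of (i, j) \<Rightarrow> e = {i, j}" unfolding ends_def by (rule someI_ex)
    then show ?thesis by (simp add: case_prod_beta)
  qed
  have image: "p ` e = {p (fst (ends e)), p (snd (ends e))}" if "e \<in> edges G" for e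
    using ends[OF that] by (metis image_insert image_empty)
  have hull: "path_image (\<gamma> e) = convex hull (p ` e)" if "e \<in> edges G" for e
    unfolding image[OF that] \<gamma>_def path_image_linepath segment_convex_hull ..
  have sub: "p ` e \<subseteq> convex hull (p ` e)" for e by (rule hull_subset)
  have ed: "e \<subseteq> verts G" if "e \<in> edges G" for e
    using that simple unfolding simple_graph_def by blast
  have "plane_drawing G p \<gamma>"
    unfolding plane_drawing_def
  proof (intro conjI ballI impI)
    show "inj_on p (verts G)" by (rule inj)
  next
    fix e assume e: "e \<in> edges G"
    have "card e = 2" using e simple unfolding simple_graph_def by blast
    then have "fst (ends e) \<noteq> snd (ends e)" using ends[OF e] by (metis card_2_iff doubleton_eq_iff insert_absorb2)
    then have "p (fst (ends e)) \<noteq> p (snd (ends e))"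
      using inj ends[OF e] ed[OF e] by (metis inj_on_contraD insertI1 insertI2 subsetD)
    then show "arc (\<gamma> e)" unfolding \<gamma>_def by (rule arc_linepath)
    show "{pathstart (\<gamma> e), pathfinish (\<gamma> e)} = p ` e" unfolding image[OF e] \<gamma>_def by simp
    \<comment> \<open>An edge avoids foreign vertices because every vertex w lies on some edge e';
      the crossing condition for e and e' then puts p w among the ends of e.\<close>
    have "p w \<in> p ` e" if w: "w \<in> verts G" "p w \<in> convex hull (p ` e)" for w
    proof -
      obtain e' where e': "e' \<in> edges G" "w \<in> e'" using no_isolated w(1) by blast
      then have "p w \<in> convex hull (p ` e')" using sub by blast
      then show ?thesis using cross[OF e e'(1)] w(2) e' by (cases "e = e'") auto
    qed
    then show "path_image (\<gamma> e) \<inter> p ` verts G = p ` e"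
      using sub[of e] ed[OF e] unfolding hull[OF e] by blast
  next
    fix e e' assume e: "e \<in> edges G" "e' \<in> edges G" "e \<noteq> e'"
    have "p ` (e \<inter> e') \<subseteq> convex hull (p ` e) \<inter> convex hull (p ` e')"
      using sub[of e] sub[of e'] by blast
    then show "path_image (\<gamma> e) \<inter> path_image (\<gamma> e') = p ` (e \<inter> e')"
      using cross[OF e] unfolding hull[OF e(1)] hull[OF e(2)] by blast
  qed
  then show ?thesis unfolding planar_def by blast
qed

section \<open>Signed graphs given by edge lists\<close>

definition graph_of :: "('a \<times> 'a \<times> sign) list \<Rightarrow> 'a ugraph" where
  "graph_of es = \<lparr>verts = (\<Union>(i, j, s)\<in>set es. {i, j}), edges = (\<lambda>(i, j, s). {i, j}) ` set es\<rparr>"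

definition signature_of :: "('a \<times> 'a \<times> sign) list \<Rightarrow> 'a set \<Rightarrow> sign" where
  "signature_of es e = (if \<exists>i j. (i, j, Neg) \<in> set es \<and> e = {i, j} then Neg else Pos)"

definition crossfree_edges :: "('a \<Rightarrow> int \<times> int) \<Rightarrow> ('a \<times> 'a \<times> sign) list \<Rightarrow> bool" where
  "crossfree_edges P es \<longleftrightarrow> sorted_wrt crossfree (map (\<lambda>(i, j, s). (P i, P j)) es)"

lemma finite_graph_of: "finite_graph (graph_of es)"
  unfolding finite_graph_def graph_of_def by auto

lemma simple_graph_of:
  assumes "\<forall>(i, j, s)\<in>set es. i \<noteq> j"
  shows "simple_graph (graph_of es)"
  using assms unfolding simple_graph_def graph_of_def by (fastforce simp: card_2_iff)

text \<open>\<open>sorted_wrt\<close> tests each pair in list order only, whence the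
  disjunction.\<close>

lemma crossfree_edges_cases:
  assumes "crossfree_edges P es" "(i, j, s) \<in> set es" "(i', j', s') \<in> set es"
    "(i, j, s) \<noteq> (i', j', s')"
  shows "crossfree (P i, P j) (P i', P j') \<or> crossfree (P i', P j') (P i, P j)"
proof -
  obtain k where k: "k < length es" "es ! k = (i, j, s)" using assms(2) by (auto simp: in_set_conv_nth)
  obtain l where l: "l < length es" "es ! l = (i', j', s')" using assms(3) by (auto simp: in_set_conv_nth)
  have "k \<noteq> l" using k l assms(4) by auto
  then consider "k < l" | "l < k" by linarith
  then show ?thesis
    using assms(1) k l unfolding crossfree_edges_def sorted_wrt_iff_nth_less
    by cases (metis (no_types, lifting) case_prod_conv length_map nth_map)+
qed

lemma planar_graph_of:
  assumes loop: "\<forall>(i, j, s)\<in>set es. i \<noteq> j" and inj: "inj_on P (verts (graph_of es))"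
    and cross: "crossfree_edges P es"
  shows "planar (graph_of es)"
proof (rule planar_straight_line[where p = "\<lambda>v. point (P v)"])
  show "simple_graph (graph_of es)" using loop by (rule simple_graph_of)
  show inj': "inj_on (\<lambda>v. point (P v)) (verts (graph_of es))"
    using inj by (simp add: inj_on_def inj_point)
  show "verts (graph_of es) \<subseteq> \<Union> (edges (graph_of es))" by (auto simp: graph_of_def)
  fix e e' assume e: "e \<in> edges (graph_of es)" "e' \<in> edges (graph_of es)" "e \<noteq> e'"
  obtain i j s where "(i, j, s) \<in> set es" "e = {i, j}" using e(1) by (auto simp: graph_of_def)
  moreover obtain i' j' s' where "(i', j', s') \<in> set es" "e' = {i', j'}"
    using e(2) by (auto simp: graph_of_def)
  ultimately have ij: "(i, j, s) \<in> set es" "e = {i, j}" "(i', j', s') \<in> set es" "e' = {i', j'}"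
    by blast+
  have V: "e \<subseteq> verts (graph_of es)" "e' \<subseteq> verts (graph_of es)"
    using ij by (auto simp: graph_of_def)
  have "crossfree (P i, P j) (P i', P j') \<or> crossfree (P i', P j') (P i, P j)"
    using crossfree_edges_cases[OF cross ij(1,3)] e(3) ij by blast
  then have "closed_segment (point (P i)) (point (P j)) \<inter> closed_segment (point (P i')) (point (P j'))
      \<subseteq> {point (P i), point (P j)} \<inter> {point (P i'), point (P j')}"
    using crossfree_closed_segments by blast
  also have "\<dots> = (\<lambda>v. point (P v)) ` e \<inter> (\<lambda>v. point (P v)) ` e'" using ij by simp
  also have "\<dots> = (\<lambda>v. point (P v)) ` (e \<inter> e')"
    using inj_on_image_Int[OF inj' V] by simp
  finally show "convex hull (\<lambda>v. point (P v)) ` e \<inter> convex hull (\<lambda>v. point (P v)) ` e'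
      \<subseteq> (\<lambda>v. point (P v)) ` (e \<inter> e')"
    using ij by (simp add: segment_convex_hull)
qed

text \<open>Two entries with the same ends give orientation 0 and fail \<open>crossfree\<close>, so
  no edge is listed with both signs and the preference for \<open>Neg\<close> in
  \<open>signature_of\<close> never overrides a positive entry.\<close>

lemma signature_of_crossfree:
  assumes cross: "crossfree_edges P es" and ij: "(i, j, s) \<in> set es"
  shows "signature_of es {i, j} = s"
proof -
  have same: "s' = s" if "(i', j', s') \<in> set es" "{i, j} = {i', j'}" for i' j' s'
  proof (rule ccontr)
    assume "s' \<noteq> s"
    then have "crossfree (P i, P j) (P i', P j') \<or> crossfree (P i', P j') (P i, P j)"
      using crossfree_edges_cases[OF cross ij that(1)] by blast
    moreover have "\<not> crossfree (a, b) (a, b)" "\<not> crossfree (a, b) (b, a)" for a b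
      by (cases a; cases b; auto simp: boxes_disjoint_def algebra_simps)+
    ultimately show False using that(2) by (metis doubleton_eq_iff)
  qed
  show ?thesis
  proof (cases s)
    case Pos
    then show ?thesis using same unfolding signature_of_def by fastforce
  next
    case Neg
    then show ?thesis using ij unfolding signature_of_def by auto
  qed
qed

lemma circular_coloring_admissible:
  assumes cross: "crossfree_edges P es" and r: "1 \<le> r" "r < 14 / 3"
    and col: "circular_coloring r (graph_of es, signature_of es) f" and e: "e \<in> set es"
  shows "admissible (\<lambda>v. f v * (14 / r)) e"
proof -
  obtain i j s where ij: "e = (i, j, s)" by (cases e)
  have sg: "signature_of es {i, j} = s" using signature_of_crossfree[OF cross] e ij by blast
  have edge: "{i, j} \<in> edges (graph_of es)" using e ij by (force simp: graph_of_def)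
  have "i \<in> verts (graph_of es)" "j \<in> verts (graph_of es)"
    using e ij by (force simp: graph_of_def)+
  then have circ: "f i \<in> circle_pts r" "f j \<in> circle_pts r"
    using col unfolding circular_coloring_def by auto
  show ?thesis
  proof (cases s)
    case Pos
    then have "circ_dist r (f i) (f j) \<ge> 1"
      using col sg edge unfolding circular_coloring_def by auto
    then show ?thesis using far_rescale[OF r] ij Pos by simp
  next
    case Neg
    then have "circ_dist r (f i) (antipode r (f j)) \<ge> 1"
      using col sg edge unfolding circular_coloring_def by auto
    then show ?thesis using near_rescale[OF circ(2) r] ij Neg by simp
  qed
qed

text \<open>Needed for the infimum to be taken over a nonempty set.\<close>

lemma circular_coloring_exists:
  fixes G :: "nat ugraph"
  assumes fin: "finite_graph G" and simple: "simple_graph G"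
  shows "\<exists>r\<ge>1. \<exists>f. circular_coloring r (G, \<sigma>) f"
proof -
  obtain N where N: "\<And>v. v \<in> verts G \<Longrightarrow> v < N"
    using fin unfolding finite_graph_def by (metis finite_nat_set_iff_bounded)
  \<comment> \<open>Each vertex is its own color. The colors stay below N and their antipodes,
    shifted by r / 2 = N + 1, stay more than 1 away from all of them.\<close>
  define r where "r = 2 * real N + 2"
  have pts: "real v \<in> circle_pts r" if "v \<in> verts G" for v
    using N[OF that] by (auto simp: circle_pts_def r_def)
  have ends: "u \<in> verts G \<and> v \<in> verts G \<and> u \<noteq> v" if "{u, v} \<in> edges G" for u v
    using that simple unfolding simple_graph_def by fastforce
  have "circular_coloring r (G, \<sigma>) real"
    unfolding circular_coloring_def prod.case
  proof (intro conjI ballI allI impI)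
    fix v assume "v \<in> verts G" then show "real v \<in> circle_pts r" by (rule pts)
  next
    fix u v assume "{u, v} \<in> edges G \<and> \<sigma> {u, v} = Pos"
    then have "u < N" "v < N" "u \<noteq> v" using ends N by blast+
    then show "1 \<le> circ_dist r (real u) (real v)"
      by (auto simp: circ_dist_def r_def)
  next
    fix u v assume "{u, v} \<in> edges G \<and> \<sigma> {u, v} = Neg"
    then have uv: "u < N" "v < N" "v \<in> verts G" using ends N by blast+
    have "antipode r (real v) = real v + (real N + 1)"
      using antipode_eq[OF pts[OF uv(3)]] uv by (simp add: r_def field_simps)
    then show "1 \<le> circ_dist r (real u) (antipode r (real v))"
      using uv by (auto simp: circ_dist_def r_def)
  qed
  moreover have "r \<ge> 1" unfolding r_def by simp
  ultimately show ?thesis by blast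
qed

section \<open>The uncolorable graph\<close>

text \<open>A gadget brings 14 new vertices, 8 of its own and 3 for each filled triangle; hence the
  offsets 4, 18, 32 and 46 vertices in all.\<close>

definition graph_edges :: "(nat \<times> nat \<times> sign) list" where
  "graph_edges = [(0, 1, Pos), (0, 2, Pos), (0, 3, Pos), (1, 2, Pos), (1, 3, Pos), (2, 3, Pos)]
     @ wenger_gadget 0 1 4 @ wenger_gadget 0 2 18 @ wenger_gadget 0 3 32"

text \<open>Vertex 0 lies inside the triangle 1, 2, 3, and each gadget occupies its own inner face
  of the K4: 012 for the edge 01, 023 for 02 and 013 for 03.\<close>

definition coords :: "(int \<times> int) list" where
  "coords =
    [(88, 30), (0, 0), (176, 0), (88, 88),
     (89, 28), (114, 2), (88, 26), (68, 4), (98, 17), (106, 9), (110, 6), (84, 8), (98, 16),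
     (96, 12), (100, 14), (80, 12), (76, 10), (79, 15),
     (98, 32), (116, 58), (100, 34), (136, 36), (110, 46), (117, 54), (116, 56), (126, 44),
     (114, 48), (117, 49), (116, 51), (126, 42), (128, 40), (124, 38),
     (79, 41), (34, 31), (76, 42), (60, 58), (57, 39), (42, 36), (38, 34), (53, 50), (52, 42),
     (51, 45), (48, 40), (58, 52), (60, 56), (62, 54)]"

lemma crossfree_graph_edges: "crossfree_edges ((!) coords) graph_edges"
  by code_simp

lemma graph_edges_less: "\<forall>(i, j, s)\<in>set graph_edges. i \<noteq> j \<and> i < 46 \<and> j < 46"
  by (simp add: graph_edges_def wenger_gadget_def triangle_gadget_def)

text \<open>The middle one of three points of (3, 11) with mutual distances above 3 lies in (6, 8),
  within 1 of the antipode 7 of the fourth vertex at 0.\<close>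

lemma k4_core:
  fixes a b c :: real
  assumes "3 < a" "a < 11" "3 < b" "b < 11" "3 < c" "c < 11"
    and "3 < \<bar>a - b\<bar>" "3 < \<bar>a - c\<bar>" "3 < \<bar>b - c\<bar>"
    and "1 \<le> \<bar>a - 7\<bar>" "1 \<le> \<bar>b - 7\<bar>" "1 \<le> \<bar>c - 7\<bar>"
  shows False
  using assms by (smt (verit))

lemma not_admissible: "\<not> (\<forall>e\<in>set graph_edges. admissible g e)"
proof
  assume adm: "\<forall>e\<in>set graph_edges. admissible g e"
  have far: "far (g i) (g j)" if "(i, j, Pos) \<in> set graph_edges" for i j
    using adm that by fastforce
  have "far (g 0) (g 1)" "far (g 0) (g 2)" "far (g 0) (g 3)"
    by (rule far, simp add: graph_edges_def)+
  then have "far (g 1) (g 0)" "far (g 2) (g 0)" "far (g 3) (g 0)"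
    using far_commute by blast+
  moreover have "far (g 1) (g 2)" "far (g 1) (g 3)" "far (g 2) (g 3)"
    by (rule far, simp add: graph_edges_def)+
  ultimately have F: "far (g 1) (g 0)" "far (g 2) (g 0)" "far (g 3) (g 0)"
      "far (g 1) (g 2)" "far (g 1) (g 3)" "far (g 2) (g 3)" by blast+
  have "\<forall>e\<in>set (wenger_gadget 0 1 4). admissible g e" "\<forall>e\<in>set (wenger_gadget 0 2 18). admissible g e"
      "\<forall>e\<in>set (wenger_gadget 0 3 32). admissible g e"
    using adm by (auto simp: graph_edges_def)
  note W = this[THEN wenger_gadget_dist]
  obtain i :: int where i: "3 < g 1 + 14 * of_int i - g 0" "g 1 + 14 * of_int i - g 0 < 11"
    using F(1) by (rule far_representative)
  obtain j :: int where j: "3 < g 2 + 14 * of_int j - g 0" "g 2 + 14 * of_int j - g 0 < 11"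
    using F(2) by (rule far_representative)
  obtain k :: int where k: "3 < g 3 + 14 * of_int k - g 0" "g 3 + 14 * of_int k - g 0 < 11"
    using F(3) by (rule far_representative)
  define a b c where defs: "a = g 1 + 14 * of_int i - g 0" "b = g 2 + 14 * of_int j - g 0"
    "c = g 3 + 14 * of_int k - g 0"
  have rng: "3 < a" "a < 11" "3 < b" "b < 11" "3 < c" "c < 11"
    using i j k unfolding defs by auto
  have "far a b" "far a c" "far b c"
    using far_shift[OF F(4), of i j, THEN far_translate[of _ _ "- g 0"]]
      far_shift[OF F(5), of i k, THEN far_translate[of _ _ "- g 0"]]
      far_shift[OF F(6), of j k, THEN far_translate[of _ _ "- g 0"]]
    unfolding defs by auto
  then have "3 < \<bar>a - b\<bar>" "3 < \<bar>a - c\<bar>" "3 < \<bar>b - c\<bar>"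
    using rng by (auto intro!: far_lift(1))
  moreover have "1 \<le> \<bar>a - 7\<bar>" "1 \<le> \<bar>b - 7\<bar>" "1 \<le> \<bar>c - 7\<bar>"
    using W(1)[of i] W(2)[of j] W(3)[of k] unfolding defs by (simp_all add: algebra_simps)
  ultimately show False using k4_core rng by blast
qed

section \<open>Membership in the class and the lower bound\<close>

lemma graph_edges_simple_planar:
  "(graph_of graph_edges, signature_of graph_edges) \<in> simple_planar_signed_graphs"
proof -
  have loop: "\<forall>(i, j, s)\<in>set graph_edges. i \<noteq> j" using graph_edges_less by auto
  have "distinct coords" unfolding coords_def by simp
  moreover have "length coords = 46" unfolding coords_def by simp
  moreover have "v < 46" if "v \<in> verts (graph_of graph_edges)" for v
    using that graph_edges_less by (auto simp: graph_of_def)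
  ultimately have "inj_on ((!) coords) (verts (graph_of graph_edges))"
    by (auto simp: inj_on_def nth_eq_iff_index_eq)
  then show ?thesis unfolding simple_planar_signed_graphs_def
    using finite_graph_of simple_graph_of[OF loop]
      planar_graph_of[OF loop _ crossfree_graph_edges] by simp
qed

lemma circular_chromatic_number_graph_edges:
  "14 / 3 \<le> circular_chromatic_number (graph_of graph_edges, signature_of graph_edges)"
  unfolding circular_chromatic_number_def
proof (rule cInf_greatest)
  have "finite_graph (graph_of graph_edges)" "simple_graph (graph_of graph_edges)"
    using graph_edges_simple_planar unfolding simple_planar_signed_graphs_def by auto
  then show "{r. 1 \<le> r \<and> (\<exists>f. circular_coloring r (graph_of graph_edges, signature_of graph_edges) f)} \<noteq> {}"
    using circular_coloring_exists by blast
next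
  fix r assume "r \<in> {r. 1 \<le> r \<and> (\<exists>f. circular_coloring r (graph_of graph_edges, signature_of graph_edges) f)}"
  then obtain f where r: "1 \<le> r"
    and f: "circular_coloring r (graph_of graph_edges, signature_of graph_edges) f" by blast
  show "14 / 3 \<le> r"
  proof (rule ccontr)
    assume "\<not> 14 / 3 \<le> r"
    then show False
      using circular_coloring_admissible[OF crossfree_graph_edges r _ f] not_admissible by fastforce
  qed
qed

theorem theorem6p3:
  "(SUP S \<in> (simple_planar_signed_graphs :: nat signed_graph set).
      ereal (circular_chromatic_number S)) \<ge> ereal (4 + 2 / 3)"
  using graph_edges_simple_planar circular_chromatic_number_graph_edges
  by (intro SUP_upper2) auto

end
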